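(* For every $i\ge1$ and every $\mathcal{L}_{\mathsf{PV}}$-sentence $\varphi$, if $\mathsf{T}^i_{\mathsf{PV}}\vdash\varphi$ then $\mathsf{U}^i_{\mathsf{PV}}\vdash\varphi$.
   Context: $\mathcal{L}_{\mathsf{PV}}$ is the first-order language with constants $0,1$, equality as the only relation, and a function symbol for every polynomial-time computable function $f:\mathbb{N}^k\to\mathbb{N}$ (numbers in binary); its standard model is $\mathbb{N}$. Bounded quantifiers are $\exists x\le t$, $\forall x\le t$ with $t$ a term not containing $x$. $\Sigma^b_0=\Pi^b_0$ are the quantifier-free formulas; for $i\ge1$, $\Sigma^b_i,\Pi^b_i$ are the smallest classes containing $\Sigma^b_{i-1}\cup\Pi^b_{i-1}$, closed under $\wedge,\vee$, with $\Sigma^b_i$ closed under bounded $\exists$, $\Pi^b_i$ under bounded $\forall$, and negation exchanging them. $\mathsf{T}^i_{\mathsf{PV}}$ is the set of all sentences $\forall\vec y\,\varphi(\vec y)$ with $\varphi\in\Sigma^b_{i-1}$ that are true in $\mathbb{N}$. For $i\ge1$, $\mathcal{L}^i_{\mathsf{PV}}$ extends $\mathcal{L}_{\mathsf{PV}}$ by: for each $(\Pi^b_{i-1}\cup\Sigma^b_{i-1})$-formula $\alpha(\vec z)$ of $\mathcal{L}_{\mathsf{PV}}$, a function symbol $f_\alpha$ interpreted in $\mathbb{N}$ as the characteristic function of $\alpha$ (value $1$ if $\alpha(\vec z)$ holds, $0$ otherwise); and, when $i\ge2$, for each $\Sigma^b_{i-1}$-formula $\beta(\vec x,y)$ and $\mathcal{L}_{\mathsf{PV}}$-term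 $t$, a function symbol $g_{\beta,t}$ interpreted as the smallest $y$ with $\beta(\vec x,y)$ if some $y\le t(\vec x)$ satisfies $\beta(\vec x,y)$, and $0$ otherwise. $\mathsf{U}^i_{\mathsf{PV}}$ is the theory of all universal $\mathcal{L}^i_{\mathsf{PV}}$-sentences true in this standard model. *)

theory Defs
  imports "HOL-Computational_Algebra.Polynomial"
begin

section \<open>Polynomial-time computable functions\<close>

text \<open>
  Deterministic multitape Turing machines with one-sided tapes. States and tape symbols are
  initial segments of the natural numbers. State 0 is initial and state 1 is the halting state;
  symbol 0 is the blank, and symbols 1 and 2 are the binary digits 0 and 1.
\<close>

datatype move = Left | Stay | Right

type_synonym tape = "nat \<times> (nat \<Rightarrow> nat)"  \<comment> \<open>head position and contents\<close>

record machine =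
  tapes :: nat
  states :: nat
  symbols :: nat
  delta :: "nat \<Rightarrow> nat list \<Rightarrow> nat \<times> (nat \<times> move) list"

definition wf_machine :: "machine \<Rightarrow> bool" where
  "wf_machine M \<longleftrightarrow> 2 \<le> states M \<and> 3 \<le> symbols M \<and>
    (\<forall>q rs. q < states M \<and> length rs = tapes M \<and> set rs \<subseteq> {..<symbols M} \<longrightarrow>
      (case delta M q rs of (q', as) \<Rightarrow>
        q' < states M \<and> length as = tapes M \<and> fst ` set as \<subseteq> {..<symbols M}))"

fun act :: "nat \<times> move \<Rightarrow> tape \<Rightarrow> tape" where
  "act (s, d) (p, T) = ((case d of Left \<Rightarrow> p - 1 | Stay \<Rightarrow> p | Right \<Rightarrow> p + 1), T(p := s))"

fun step :: "machine \<Rightarrow> nat \<times> tape list \<Rightarrow> nat \<times> tape list" where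
  "step M (q, ts) =
    (if q = 1 then (q, ts)
     else case delta M q (map (\<lambda>(p, T). T p) ts) of (q', as) \<Rightarrow> (q', map2 act as ts))"

text \<open>Binary representation, least significant digit first; 0 is the empty word.\<close>

fun bits :: "nat \<Rightarrow> bool list" where
  "bits n = (if n = 0 then [] else odd n # bits (n div 2))"

declare bits.simps [simp del]

definition tape_of :: "bool list \<Rightarrow> nat \<Rightarrow> nat" where
  "tape_of w j = (if j < length w then (if w ! j then 2 else 1) else 0)"

definition initial :: "machine \<Rightarrow> nat list \<Rightarrow> nat \<times> tape list" where
  "initial M xs =
    (0, map (\<lambda>x. (0, tape_of (bits x))) xs @ replicate (tapes M - length xs) (0, tape_of []))"

text \<open>
  A \<open>k\<close>-ary function is a function on lists of length \<open>k\<close>, made 0 elsewhere so that different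
  HOL functions are different \<open>k\<close>-ary functions. The arguments are given on tapes
  \<open>0, \<dots>, k - 1\<close>, the value is read off tape \<open>k\<close>, and the number of steps is polynomial in the
  total length of the arguments.
\<close>

definition polytime :: "nat \<Rightarrow> (nat list \<Rightarrow> nat) \<Rightarrow> bool" where
  "polytime k f \<longleftrightarrow>
    (\<forall>xs. length xs \<noteq> k \<longrightarrow> f xs = 0) \<and>
    (\<exists>M. \<exists>p :: nat poly. wf_machine M \<and> k < tapes M \<and>
      (\<forall>xs. length xs = k \<longrightarrow>
        (\<exists>n q ts. n \<le> poly p (\<Sum>x\<leftarrow>xs. length (bits x)) \<and>
          (step M ^^ n) (initial M xs) = (q, ts) \<and> q = 1 \<and>
          snd (ts ! k) = tape_of (bits (f xs)))))"


section \<open>First-order logic with equality\<close>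

text \<open>Variables are de Bruijn indices: index 0 refers to the innermost enclosing quantifier.\<close>

datatype 'f trm = Var nat | Fn 'f "'f trm list"

datatype 'f form =
    Eq "'f trm" "'f trm"
  | Neg "'f form"
  | And "'f form" "'f form"
  | Or "'f form" "'f form"
  | Ex "'f form"
  | All "'f form"

text \<open>A language assigns an arity to each of its symbols, and \<open>None\<close> to everything else.\<close>

type_synonym 'f language = "'f \<Rightarrow> nat option"

fun wf_trm :: "'f language \<Rightarrow> 'f trm \<Rightarrow> bool" where
  "wf_trm L (Var n) = True"
| "wf_trm L (Fn f ts) = (L f = Some (length ts) \<and> (\<forall>t \<in> set ts. wf_trm L t))"

fun wf_form :: "'f language \<Rightarrow> 'f form \<Rightarrow> bool" where
  "wf_form L (Eq s t) = (wf_trm L s \<and> wf_trm L t)"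
| "wf_form L (Neg A) = wf_form L A"
| "wf_form L (And A B) = (wf_form L A \<and> wf_form L B)"
| "wf_form L (Or A B) = (wf_form L A \<and> wf_form L B)"
| "wf_form L (Ex A) = wf_form L A"
| "wf_form L (All A) = wf_form L A"

text \<open>All free variables are among the indices below \<open>k\<close>.\<close>

fun trm_below :: "nat \<Rightarrow> 'f trm \<Rightarrow> bool" where
  "trm_below k (Var n) = (n < k)"
| "trm_below k (Fn f ts) = (\<forall>t \<in> set ts. trm_below k t)"

fun form_below :: "nat \<Rightarrow> 'f form \<Rightarrow> bool" where
  "form_below k (Eq s t) = (trm_below k s \<and> trm_below k t)"
| "form_below k (Neg A) = form_below k A"
| "form_below k (And A B) = (form_below k A \<and> form_below k B)"
| "form_below k (Or A B) = (form_below k A \<and> form_below k B)"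
| "form_below k (Ex A) = form_below (Suc k) A"
| "form_below k (All A) = form_below (Suc k) A"

definition sentence :: "'f language \<Rightarrow> 'f form \<Rightarrow> bool" where
  "sentence L A \<longleftrightarrow> wf_form L A \<and> form_below 0 A"

fun qfree :: "'f form \<Rightarrow> bool" where
  "qfree (Eq s t) = True"
| "qfree (Neg A) = qfree A"
| "qfree (And A B) = (qfree A \<and> qfree B)"
| "qfree (Or A B) = (qfree A \<and> qfree B)"
| "qfree (Ex A) = False"
| "qfree (All A) = False"

fun subst_trm :: "(nat \<Rightarrow> 'f trm) \<Rightarrow> 'f trm \<Rightarrow> 'f trm" where
  "subst_trm \<sigma> (Var n) = \<sigma> n"
| "subst_trm \<sigma> (Fn f ts) = Fn f (map (subst_trm \<sigma>) ts)"

abbreviation lift_trm :: "'f trm \<Rightarrow> 'f trm" where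
  "lift_trm \<equiv> subst_trm (\<lambda>n. Var (Suc n))"

definition up :: "(nat \<Rightarrow> 'f trm) \<Rightarrow> nat \<Rightarrow> 'f trm" where
  "up \<sigma> = case_nat (Var 0) (\<lambda>n. lift_trm (\<sigma> n))"

fun subst_form :: "(nat \<Rightarrow> 'f trm) \<Rightarrow> 'f form \<Rightarrow> 'f form" where
  "subst_form \<sigma> (Eq s t) = Eq (subst_trm \<sigma> s) (subst_trm \<sigma> t)"
| "subst_form \<sigma> (Neg A) = Neg (subst_form \<sigma> A)"
| "subst_form \<sigma> (And A B) = And (subst_form \<sigma> A) (subst_form \<sigma> B)"
| "subst_form \<sigma> (Or A B) = Or (subst_form \<sigma> A) (subst_form \<sigma> B)"
| "subst_form \<sigma> (Ex A) = Ex (subst_form (up \<sigma>) A)"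
| "subst_form \<sigma> (All A) = All (subst_form (up \<sigma>) A)"

abbreviation lift_form :: "'f form \<Rightarrow> 'f form" where
  "lift_form \<equiv> subst_form (\<lambda>n. Var (Suc n))"

definition inst :: "'f trm \<Rightarrow> 'f form \<Rightarrow> 'f form" where
  "inst t A = subst_form (case_nat t Var) A"

fun eval :: "('f \<Rightarrow> 'a list \<Rightarrow> 'a) \<Rightarrow> (nat \<Rightarrow> 'a) \<Rightarrow> 'f trm \<Rightarrow> 'a" where
  "eval I e (Var n) = e n"
| "eval I e (Fn f ts) = I f (map (eval I e) ts)"

fun sat :: "('f \<Rightarrow> 'a list \<Rightarrow> 'a) \<Rightarrow> (nat \<Rightarrow> 'a) \<Rightarrow> 'f form \<Rightarrow> bool" where
  "sat I e (Eq s t) = (eval I e s = eval I e t)"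
| "sat I e (Neg A) = (\<not> sat I e A)"
| "sat I e (And A B) = (sat I e A \<and> sat I e B)"
| "sat I e (Or A B) = (sat I e A \<or> sat I e B)"
| "sat I e (Ex A) = (\<exists>a. sat I (case_nat a e) A)"
| "sat I e (All A) = (\<forall>a. sat I (case_nat a e) A)"

definition true_in :: "('f \<Rightarrow> 'a list \<Rightarrow> 'a) \<Rightarrow> 'f form \<Rightarrow> bool" where
  "true_in I A \<longleftrightarrow> (\<forall>e. sat I e A)"

text \<open>
  Classical natural deduction with equality, all of whose formulas belong to the language.
  The context of hypotheses may be infinite, so that it can be a theory; lifting it in
  \<open>ExE\<close> and \<open>AllI\<close> makes index 0 the eigenvariable.
\<close>

inductive proves :: "'f language \<Rightarrow> 'f form set \<Rightarrow> 'f form \<Rightarrow> bool" for L where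
  Assm: "A \<in> \<Gamma> \<Longrightarrow> wf_form L A \<Longrightarrow> proves L \<Gamma> A"
| NegI: "wf_form L A \<Longrightarrow> proves L (insert A \<Gamma>) B \<Longrightarrow> proves L (insert A \<Gamma>) (Neg B) \<Longrightarrow>
    proves L \<Gamma> (Neg A)"
| Contr: "wf_form L A \<Longrightarrow> proves L (insert (Neg A) \<Gamma>) B \<Longrightarrow>
    proves L (insert (Neg A) \<Gamma>) (Neg B) \<Longrightarrow> proves L \<Gamma> A"
| AndI: "proves L \<Gamma> A \<Longrightarrow> proves L \<Gamma> B \<Longrightarrow> proves L \<Gamma> (And A B)"
| AndE1: "proves L \<Gamma> (And A B) \<Longrightarrow> proves L \<Gamma> A"
| AndE2: "proves L \<Gamma> (And A B) \<Longrightarrow> proves L \<Gamma> B"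
| OrI1: "proves L \<Gamma> A \<Longrightarrow> wf_form L B \<Longrightarrow> proves L \<Gamma> (Or A B)"
| OrI2: "proves L \<Gamma> B \<Longrightarrow> wf_form L A \<Longrightarrow> proves L \<Gamma> (Or A B)"
| OrE: "proves L \<Gamma> (Or A B) \<Longrightarrow> proves L (insert A \<Gamma>) C \<Longrightarrow> proves L (insert B \<Gamma>) C \<Longrightarrow>
    proves L \<Gamma> C"
| ExI: "wf_form L A \<Longrightarrow> wf_trm L t \<Longrightarrow> proves L \<Gamma> (inst t A) \<Longrightarrow> proves L \<Gamma> (Ex A)"
| ExE: "proves L \<Gamma> (Ex A) \<Longrightarrow> proves L (insert A (lift_form ` \<Gamma>)) (lift_form C) \<Longrightarrow>
    proves L \<Gamma> C"
| AllI: "proves L (lift_form ` \<Gamma>) A \<Longrightarrow> proves L \<Gamma> (All A)"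
| AllE: "proves L \<Gamma> (All A) \<Longrightarrow> wf_trm L t \<Longrightarrow> proves L \<Gamma> (inst t A)"
| EqI: "wf_trm L t \<Longrightarrow> proves L \<Gamma> (Eq t t)"
| EqE: "wf_form L A \<Longrightarrow> proves L \<Gamma> (Eq s t) \<Longrightarrow> proves L \<Gamma> (inst s A) \<Longrightarrow>
    proves L \<Gamma> (inst t A)"


section \<open>The language of PV and its bounded formulas\<close>

datatype pv_symbol = Zero | One | PolyF nat "nat list \<Rightarrow> nat"

fun L_PV :: "pv_symbol language" where
  "L_PV Zero = Some 0"
| "L_PV One = Some 0"
| "L_PV (PolyF k f) = (if polytime k f then Some k else None)"

fun I_PV :: "pv_symbol \<Rightarrow> nat list \<Rightarrow> nat" where
  "I_PV Zero xs = 0"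
| "I_PV One xs = 1"
| "I_PV (PolyF k f) xs = f xs"

text \<open>
  Equality being the only relation, \<open>s \<le> t\<close> is the equation \<open>leq(s, t) = 1\<close> for the
  characteristic function of the order, which is a symbol of the language by \<open>polytime_leq\<close> below.
\<close>

fun leq :: "nat list \<Rightarrow> nat" where
  "leq [x, y] = (if x \<le> y then 1 else 0)"
| "leq _ = 0"

definition Leq :: "pv_symbol trm \<Rightarrow> pv_symbol trm \<Rightarrow> pv_symbol form" where
  "Leq s t = Eq (Fn (PolyF 2 leq) [s, t]) (Fn One [])"

text \<open>Lifting the bound says that it does not contain the quantified variable.\<close>

definition BEx :: "pv_symbol trm \<Rightarrow> pv_symbol form \<Rightarrow> pv_symbol form" where
  "BEx t A = Ex (And (Leq (Var 0) (lift_trm t)) A)"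

definition BAll :: "pv_symbol trm \<Rightarrow> pv_symbol form \<Rightarrow> pv_symbol form" where
  "BAll t A = All (Or (Neg (Leq (Var 0) (lift_trm t))) A)"

text \<open>
  The classes are defined on raw formulas; wherever they are used, well-formedness in \<open>L_PV\<close> is
  required in addition.
\<close>

inductive Sigma_b :: "nat \<Rightarrow> pv_symbol form \<Rightarrow> bool"
  and Pi_b :: "nat \<Rightarrow> pv_symbol form \<Rightarrow> bool" where
  "qfree A \<Longrightarrow> Sigma_b 0 A"
| "qfree A \<Longrightarrow> Pi_b 0 A"
| "Sigma_b i A \<Longrightarrow> Sigma_b (Suc i) A"
| "Pi_b i A \<Longrightarrow> Sigma_b (Suc i) A"
| "Sigma_b i A \<Longrightarrow> Pi_b (Suc i) A"
| "Pi_b i A \<Longrightarrow> Pi_b (Suc i) A"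
| "Sigma_b (Suc i) A \<Longrightarrow> Sigma_b (Suc i) B \<Longrightarrow> Sigma_b (Suc i) (And A B)"
| "Sigma_b (Suc i) A \<Longrightarrow> Sigma_b (Suc i) B \<Longrightarrow> Sigma_b (Suc i) (Or A B)"
| "Pi_b (Suc i) A \<Longrightarrow> Pi_b (Suc i) B \<Longrightarrow> Pi_b (Suc i) (And A B)"
| "Pi_b (Suc i) A \<Longrightarrow> Pi_b (Suc i) B \<Longrightarrow> Pi_b (Suc i) (Or A B)"
| "Sigma_b (Suc i) A \<Longrightarrow> Sigma_b (Suc i) (BEx t A)"
| "Pi_b (Suc i) A \<Longrightarrow> Pi_b (Suc i) (BAll t A)"
| "Pi_b (Suc i) A \<Longrightarrow> Sigma_b (Suc i) (Neg A)"
| "Sigma_b (Suc i) A \<Longrightarrow> Pi_b (Suc i) (Neg A)"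


section \<open>The two theories\<close>

definition T_PV :: "nat \<Rightarrow> pv_symbol form set" where
  "T_PV i = {(All ^^ n) A | n A.
     Sigma_b (i - 1) A \<and> sentence L_PV ((All ^^ n) A) \<and> true_in I_PV ((All ^^ n) A)}"

text \<open>
  \<open>CharF k \<alpha>\<close> is the characteristic function of \<open>\<alpha>(z\<^sub>0, \<dots>, z\<^sub>k\<^sub>-\<^sub>1)\<close>, where \<open>z\<^sub>j\<close> is the
  variable with index \<open>j\<close>. \<open>MinF k \<beta> t\<close> is the bounded minimization of
  \<open>\<beta>(x\<^sub>0, \<dots>, x\<^sub>k\<^sub>-\<^sub>1, y)\<close> below \<open>t(x\<^sub>0, \<dots>, x\<^sub>k\<^sub>-\<^sub>1)\<close>: in \<open>\<beta>\<close> the variable \<open>y\<close> has index 0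
  and \<open>x\<^sub>j\<close> has index \<open>j + 1\<close>, whereas in \<open>t\<close> the variable \<open>x\<^sub>j\<close> has index \<open>j\<close>.
\<close>

datatype pvi_symbol =
    Base pv_symbol
  | CharF nat "pv_symbol form"
  | MinF nat "pv_symbol form" "pv_symbol trm"

fun L_PVi :: "nat \<Rightarrow> pvi_symbol language" where
  "L_PVi i (Base f) = L_PV f"
| "L_PVi i (CharF k \<alpha>) =
    (if wf_form L_PV \<alpha> \<and> form_below k \<alpha> \<and> (Pi_b (i - 1) \<alpha> \<or> Sigma_b (i - 1) \<alpha>)
     then Some k else None)"
| "L_PVi i (MinF k \<beta> t) =
    (if 2 \<le> i \<and> wf_form L_PV \<beta> \<and> form_below (Suc k) \<beta> \<and> Sigma_b (i - 1) \<beta> \<and>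
        wf_trm L_PV t \<and> trm_below k t
     then Some k else None)"

fun I_PVi :: "pvi_symbol \<Rightarrow> nat list \<Rightarrow> nat" where
  "I_PVi (Base f) xs = I_PV f xs"
| "I_PVi (CharF k \<alpha>) xs = (if sat I_PV (\<lambda>j. xs ! j) \<alpha> then 1 else 0)"
| "I_PVi (MinF k \<beta> t) xs =
    (if \<exists>y \<le> eval I_PV (\<lambda>j. xs ! j) t. sat I_PV (case_nat y (\<lambda>j. xs ! j)) \<beta>
     then LEAST y. sat I_PV (case_nat y (\<lambda>j. xs ! j)) \<beta>
     else 0)"

definition U_PV :: "nat \<Rightarrow> pvi_symbol form set" where
  "U_PV i = {(All ^^ n) A | n A.
     qfree A \<and> sentence (L_PVi i) ((All ^^ n) A) \<and> true_in I_PVi ((All ^^ n) A)}"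


section \<open>The order is a symbol of the language\<close>

text \<open>
  State 0 records that the part of the first argument read so far is at most that of the second,
  state 2 that it is greater.
\<close>

definition leq_machine :: machine where
  "leq_machine = \<lparr>tapes = 3, states = 3, symbols = 3,
     delta = (\<lambda>q rs.
       if rs ! 0 = 0 \<and> rs ! 1 = 0
       then (1, [(0, Stay), (0, Stay), (if q = 0 then 2 else 0, Stay)])
       else (if (rs ! 0 = 2) = (rs ! 1 = 2) then q else if rs ! 1 = 2 then 0 else 2,
             [(rs ! 0, Right), (rs ! 1, Right), (rs ! 2, Stay)]))\<rparr>"

lemma wf_leq_machine: "wf_machine leq_machine"
proof -
  have "\<exists>a b c. rs = [a, b, c]" if "length rs = 3" for rs :: "nat list"
    using that by (auto simp: length_Suc_conv numeral_3_eq_3)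
  then show ?thesis
    by (fastforce simp: wf_machine_def leq_machine_def)
qed

lemma less_length_bits: "j < length (bits x) \<longleftrightarrow> x div 2 ^ j \<noteq> 0"
proof (induction x arbitrary: j rule: bits.induct)
  case (1 x)
  then show ?case
    by (subst bits.simps) (cases j; auto simp: div_mult2_eq)
qed

lemma nth_bits: "j < length (bits x) \<Longrightarrow> bits x ! j = odd (x div 2 ^ j)"
proof (induction x arbitrary: j rule: bits.induct)
  case (1 x)
  then have "x \<noteq> 0" by (metis less_length_bits div_0)
  then have eq: "bits x = odd x # bits (x div 2)" by (simp add: bits.simps[of x])
  show ?case
    using 1 \<open>x \<noteq> 0\<close> by (cases j) (simp_all add: eq div_mult2_eq)
qed

lemma tape_of_bits:
  "tape_of (bits x) j = (if x div 2 ^ j = 0 then 0 else if odd (x div 2 ^ j) then 2 else 1)"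
  using less_length_bits[of j x] nth_bits[of j x] by (auto simp: tape_of_def)

lemma mod_two_power_Suc:
  "(x :: nat) mod 2 ^ Suc n = x mod 2 ^ n + (if odd (x div 2 ^ n) then 2 ^ n else 0)"
  using mod_mult2_eq[of x "2 ^ n" 2] by (auto simp: mult.commute odd_iff_mod_2_eq_one)

lemma mod_two_power_Suc_le:
  fixes x y :: nat
  shows "x mod 2 ^ Suc n \<le> y mod 2 ^ Suc n \<longleftrightarrow>
    (if odd (x div 2 ^ n) = odd (y div 2 ^ n) then x mod 2 ^ n \<le> y mod 2 ^ n
     else odd (y div 2 ^ n))"
proof -
  have "x mod 2 ^ n < 2 ^ n" "y mod 2 ^ n < 2 ^ n" by auto
  then show ?thesis
    unfolding mod_two_power_Suc
    by (cases "odd (x div 2 ^ n)"; cases "odd (y div 2 ^ n)")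
      (simp_all only: if_True if_False simp_thms, linarith+)
qed

lemma leq_machine_run:
  "n \<le> max (length (bits x)) (length (bits y)) \<Longrightarrow>
   (step leq_machine ^^ n) (initial leq_machine [x, y]) =
     (if x mod 2 ^ n \<le> y mod 2 ^ n then 0 else 2,
      [(n, tape_of (bits x)), (n, tape_of (bits y)), (0, tape_of [])])"
proof (induction n)
  case 0
  show ?case by (simp add: initial_def leq_machine_def)
next
  case (Suc n)
  then have "n < length (bits x) \<or> n < length (bits y)" by linarith
  then have nz: "\<not> (x div 2 ^ n = 0 \<and> y div 2 ^ n = 0)"
    unfolding less_length_bits by blast
  have dig: "(tape_of (bits z) n = 0) = (z div 2 ^ n = 0)"
    "(tape_of (bits z) n = 2) = odd (z div 2 ^ n)" for z
    by (auto simp: tape_of_bits)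
  have IH: "(step leq_machine ^^ n) (initial leq_machine [x, y]) =
     (if x mod 2 ^ n \<le> y mod 2 ^ n then 0 else 2,
      [(n, tape_of (bits x)), (n, tape_of (bits y)), (0, tape_of [])])"
    using Suc by simp
  show ?case
    using nz
    by (simp only: funpow.simps comp_apply IH mod_two_power_Suc_le)
      (auto simp: leq_machine_def dig simp del: div_eq_0_iff)
qed

lemma polytime_leq: "polytime 2 leq"
proof -
  have "\<exists>n q ts. n \<le> poly [:1, 1:] (\<Sum>x\<leftarrow>xs. length (bits x)) \<and>
      (step leq_machine ^^ n) (initial leq_machine xs) = (q, ts) \<and> q = 1 \<and>
      snd (ts ! 2) = tape_of (bits (leq xs))" if len: "length xs = 2" for xs
  proof -
    obtain x y where xs: "xs = [x, y]"
      using len by (cases xs rule: leq.cases) auto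
    define n where "n = max (length (bits x)) (length (bits y))"
    have nz: "x div 2 ^ n = 0" "y div 2 ^ n = 0"
      using less_length_bits[of n x] less_length_bits[of n y] by (auto simp: n_def)
    then have lt: "x mod 2 ^ n = x" "y mod 2 ^ n = y"
      by (auto simp: div_eq_0_iff)
    have dig: "tape_of (bits x) n = 0" "tape_of (bits y) n = 0"
      using nz by (simp_all add: tape_of_bits)
    have out: "bits 0 = []" "bits 1 = [True]"
      by (simp_all add: bits.simps)
    have run: "(step leq_machine ^^ n) (initial leq_machine [x, y]) =
       (if x \<le> y then 0 else 2,
        [(n, tape_of (bits x)), (n, tape_of (bits y)), (0, tape_of [])])"
      using leq_machine_run[of n x y] by (simp add: n_def[symmetric] lt)
    have fin: "(step leq_machine ^^ Suc n) (initial leq_machine [x, y]) =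
       (1, [(n, (tape_of (bits x))(n := 0)), (n, (tape_of (bits y))(n := 0)),
            (0, (tape_of [])(0 := if x \<le> y then 2 else 0))])"
      by (simp only: funpow.simps comp_apply run) (simp add: leq_machine_def dig)
    have "(tape_of [])(0 := if x \<le> y then 2 else 0) = tape_of (bits (leq [x, y]))"
      by (rule ext) (simp add: out[simplified] tape_of_def)
    moreover have "Suc n \<le> poly [:1, 1:] (\<Sum>x\<leftarrow>xs. length (bits x))"
      by (simp add: xs n_def)
    ultimately show ?thesis
      using fin unfolding xs
      by (intro exI conjI) (assumption, assumption, rule refl, simp)
  qed
  moreover have "leq xs = 0" if "length xs \<noteq> 2" for xs
    using that by (cases xs rule: leq.cases) auto
  moreover have "2 < tapes leq_machine"
    by (simp add: leq_machine_def)
  ultimately show ?thesis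
    unfolding polytime_def using wf_leq_machine by blast
qed

end

theory Submission imports Defs
begin

text \<open>
  Every formula \<open>A\<close> of the classes \<open>\<Sigma>\<^sup>b\<^sub>j\<close>, \<open>\<Pi>\<^sup>b\<^sub>j\<close> with \<open>j < i\<close> is equivalent, over the universal
  theory, to the atom \<open>f\<^sub>A(x) = 1\<close>. This goes by induction on \<open>A\<close>: every propositional step is
  an equivalence of quantifier-free formulas, and a bounded existential quantifier is witnessed by
  the minimization symbol \<open>g\<close> (a universal one is refuted by the symbol \<open>g\<close> of the negated
  matrix), so that it too is governed by true universal sentences. If \<open>A\<close> is true, then so is the
  universal sentence \<open>f\<^sub>A(x) = 1\<close>, whence the universal closure of \<open>A\<close> is provable.
\<close>

section \<open>Substitution\<close>

lemma up_simps [simp]: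
  "up \<sigma> 0 = Var 0"
  "up \<sigma> (Suc n) = lift_trm (\<sigma> n)"
  by (simp_all add: up_def)

lemma subst_subst_trm: "subst_trm \<sigma> (subst_trm \<tau> t) = subst_trm (\<lambda>n. subst_trm \<sigma> (\<tau> n)) t"
  by (induction t) auto

lemma up_comp: "subst_trm (up \<sigma>) (up \<tau> n) = up (\<lambda>n. subst_trm \<sigma> (\<tau> n)) n"
  by (cases n) (simp_all add: subst_subst_trm)

lemma subst_subst_form:
  "subst_form \<sigma> (subst_form \<tau> A) = subst_form (\<lambda>n. subst_trm \<sigma> (\<tau> n)) A"
  by (induction A arbitrary: \<sigma> \<tau>) (simp_all add: subst_subst_trm up_comp)

lemma subst_trm_id: "trm_below k t \<Longrightarrow> (\<And>j. j < k \<Longrightarrow> \<sigma> j = Var j) \<Longrightarrow> subst_trm \<sigma> t = t"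
  by (induction t) (auto intro: map_idI)

lemma subst_form_id: "form_below k A \<Longrightarrow> (\<And>j. j < k \<Longrightarrow> \<sigma> j = Var j) \<Longrightarrow> subst_form \<sigma> A = A"
proof (induction A arbitrary: k \<sigma>)
  case (Ex A)
  have "up \<sigma> j = Var j" if "j < Suc k" for j
    using that Ex.prems(2) by (cases j) auto
  with Ex show ?case by auto
next
  case (All A)
  have "up \<sigma> j = Var j" if "j < Suc k" for j
    using that All.prems(2) by (cases j) auto
  with All show ?case by auto
qed (auto intro: subst_trm_id)

section \<open>Bounds on free variables\<close>

lemma trm_below_mono: "trm_below k t \<Longrightarrow> k \<le> l \<Longrightarrow> trm_below l t"
  by (induction t) auto

lemma form_below_mono: "form_below k A \<Longrightarrow> k \<le> l \<Longrightarrow> form_below l A"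
  by (induction A arbitrary: k l) (auto intro: trm_below_mono)

lemma ex_trm_below: "\<exists>k. trm_below k t"
proof (induction t)
  case (Var n)
  then show ?case by (auto intro: exI[of _ "Suc n"])
next
  case (Fn f ts)
  then obtain k where "trm_below (k t) t" if "t \<in> set ts" for t by metis
  \<comment> \<open>The sum serves as common bound because it dominates every summand and also
    covers an empty argument list.\<close>
  then have "trm_below (\<Sum>t\<leftarrow>ts. k t) t" if "t \<in> set ts" for t
    using that trm_below_mono[of "k t" t] member_le_sum_list[of "k t" "map k ts"] by simp
  then show ?case by auto
qed

lemma ex_form_below: "\<exists>k. form_below k A"
proof (induction A)
  case (Eq s t)
  obtain k l where "trm_below k s" "trm_below l t" using ex_trm_below by blast
  then have "form_below (max k l) (Eq s t)" by (auto intro: trm_below_mono)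
  then show ?case ..
next
  case (And A B)
  then obtain k l where "form_below k A" "form_below l B" by blast
  then have "form_below (max k l) (And A B)" by (auto intro: form_below_mono)
  then show ?case ..
next
  case (Or A B)
  then obtain k l where "form_below k A" "form_below l B" by blast
  then have "form_below (max k l) (Or A B)" by (auto intro: form_below_mono)
  then show ?case ..
next
  case (Ex A)
  then obtain k where "form_below k A" by blast
  then have "form_below k (Ex A)" by (auto intro: form_below_mono)
  then show ?case ..
next
  case (All A)
  then obtain k where "form_below k A" by blast
  then have "form_below k (All A)" by (auto intro: form_below_mono)
  then show ?case ..
qed simp

lemma subst_form_Var [simp]: "subst_form Var A = A"
  using ex_form_below subst_form_id by blast

text \<open>The instantiation undoes the lift that \<open>up\<close> applies to each
  \<open>\<sigma> n\<close>. An instantiation that follows a substitution can thus be absorbed into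
  a single substitution.\<close>

lemma inst_up: "inst t (subst_form (up \<sigma>) A) = subst_form (case_nat t \<sigma>) A"
proof -
  have "subst_trm (case_nat t Var) (up \<sigma> n) = case_nat t \<sigma> n" for n
  proof (cases n)
    case (Suc m)
    obtain k where "trm_below k (\<sigma> m)" using ex_trm_below by blast
    then show ?thesis using Suc by (simp add: subst_subst_trm subst_trm_id)
  qed simp
  then show ?thesis by (simp add: inst_def subst_subst_form)
qed

text \<open>Opening a lifted quantified formula at the eigenvariable, which is what the rules
  \<open>ExE\<close> and \<open>AllI\<close> leave to be done.\<close>

lemma inst_Var_0_up_lift: "inst (Var 0) (subst_form (up (\<lambda>n. Var (Suc n))) A) = A"
proof -
  have "case_nat (Var 0) (\<lambda>n. Var (Suc n)) = (Var :: nat \<Rightarrow> 'a trm)"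
    by (rule ext) (simp split: nat.split)
  then show ?thesis by (simp add: inst_up)
qed

section \<open>Syntactic conditions under substitution and quantifier blocks\<close>

lemma trm_below_lift [simp]: "trm_below (Suc k) (lift_trm t) = trm_below k t"
  by (induction t) auto

lemma wf_subst_trm: "(\<And>n. wf_trm L (\<sigma> n)) \<Longrightarrow> wf_trm L (subst_trm \<sigma> t) = wf_trm L t"
  by (induction t) auto

lemma wf_up: "(\<And>n. wf_trm L (\<sigma> n)) \<Longrightarrow> wf_trm L (up \<sigma> n)"
  by (cases n) (simp_all add: wf_subst_trm)

lemma wf_subst_form: "(\<And>n. wf_trm L (\<sigma> n)) \<Longrightarrow> wf_form L (subst_form \<sigma> A) = wf_form L A"
  by (induction A arbitrary: \<sigma>) (simp_all add: wf_subst_trm wf_up)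

lemma wf_inst: "wf_trm L t \<Longrightarrow> wf_form L (inst t A) = wf_form L A"
  unfolding inst_def by (rule wf_subst_form) (simp split: nat.split)

lemma qfree_subst [simp]: "qfree (subst_form \<sigma> A) = qfree A"
  by (induction A arbitrary: \<sigma>) auto

lemma wf_All_pow [simp]: "wf_form L ((All ^^ n) A) = wf_form L A"
  by (induction n) auto

lemma form_below_All_pow [simp]: "form_below k ((All ^^ n) A) = form_below (k + n) A"
  by (induction n arbitrary: k) auto


section \<open>Semantics\<close>

lemma eval_subst: "eval I e (subst_trm \<sigma> t) = eval I (\<lambda>n. eval I e (\<sigma> n)) t"
  by (induction t) (auto simp: comp_def cong: map_cong)

lemma eval_up: "(\<lambda>n. eval I (case_nat a e) (up \<sigma> n)) = case_nat a (\<lambda>n. eval I e (\<sigma> n))"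
  by (rule ext) (simp add: eval_subst split: nat.split)

lemma sat_subst: "sat I e (subst_form \<sigma> A) = sat I (\<lambda>n. eval I e (\<sigma> n)) A"
  by (induction A arbitrary: e \<sigma>) (simp_all add: eval_subst eval_up)

lemma sat_inst: "sat I e (inst t A) = sat I (case_nat (eval I e t) e) A"
proof -
  have "(\<lambda>n. eval I e (case_nat t Var n)) = case_nat (eval I e t) e"
    by (rule ext) (simp split: nat.split)
  then show ?thesis by (simp add: inst_def sat_subst)
qed

lemma eval_cong: "trm_below k t \<Longrightarrow> (\<And>j. j < k \<Longrightarrow> e j = e' j) \<Longrightarrow> eval I e t = eval I e' t"
  by (induction t) (auto intro!: arg_cong[of _ _ "I _"])

lemma sat_cong: "form_below k A \<Longrightarrow> (\<And>j. j < k \<Longrightarrow> e j = e' j) \<Longrightarrow> sat I e A = sat I e' A"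
proof (induction A arbitrary: k e e')
  case (Eq s t)
  then show ?case using eval_cong[of k s e e' I] eval_cong[of k t e e' I] by simp
next
  case (Neg A)
  have "sat I e A = sat I e' A"
    using Neg.prems by (intro Neg.IH[of k]) simp_all
  then show ?case by simp
next
  case (And A B)
  then show ?case by (metis form_below.simps(3) sat.simps(3))
next
  case (Or A B)
  then show ?case by (metis form_below.simps(4) sat.simps(4))
next
  case (Ex A)
  have "sat I (case_nat a e) A = sat I (case_nat a e') A" for a
    using Ex.prems by (intro Ex.IH[of "Suc k"]) (auto split: nat.split)
  then show ?case by simp
next
  case (All A)
  have "sat I (case_nat a e) A = sat I (case_nat a e') A" for a
    using All.prems by (intro All.IH[of "Suc k"]) (auto split: nat.split)
  then show ?case by simp
qed

lemma case_nat_eta: "case_nat (e 0) (\<lambda>n. e (Suc n)) = e"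
  by (rule ext) (simp split: nat.split)

text \<open>Truth already ranges over all environments, and every environment splits into its value
  at index 0 and its shift.\<close>

lemma true_in_All: "true_in I (All A) = true_in I A"
proof -
  have "sat I e A" if "\<And>e a. sat I (case_nat a e) A" for e
    using that[of "e 0" "\<lambda>n. e (Suc n)"] by (simp add: case_nat_eta)
  then show ?thesis unfolding true_in_def sat.simps by blast
qed

lemma true_in_All_pow [simp]: "true_in I ((All ^^ n) A) = true_in I A"
  by (induction n) (simp_all add: true_in_All)


section \<open>Derivations\<close>

lemma proves_wf: "proves L \<Gamma> A \<Longrightarrow> wf_form L A"
  by (induction rule: proves.induct) (auto simp: wf_inst wf_subst_form)

lemma proves_mono: "proves L \<Gamma> A \<Longrightarrow> \<Gamma> \<subseteq> \<Delta> \<Longrightarrow> proves L \<Delta> A"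
proof (induction arbitrary: \<Delta> rule: proves.induct)
  case (NegI A \<Gamma> B)
  then show ?case by (meson insert_mono proves.NegI)
next
  case (Contr A \<Gamma> B)
  then show ?case by (meson insert_mono proves.Contr)
next
  case (OrE \<Gamma> A B C)
  then show ?case by (meson insert_mono proves.OrE)
next
  case (ExE \<Gamma> A C)
  then have "insert A (lift_form ` \<Gamma>) \<subseteq> insert A (lift_form ` \<Delta>)" by blast
  then show ?case using ExE.IH ExE.prems by (blast intro: proves.ExE)
next
  case (AllI \<Gamma> A)
  then have "lift_form ` \<Gamma> \<subseteq> lift_form ` \<Delta>" by blast
  then show ?case using AllI.IH by (blast intro: proves.AllI)
qed (blast intro: proves.intros)+

text \<open>Disjunction elimination applied to \<open>Or A A\<close> discharges the hypothesis; the
  calculus has neither a cut rule nor implication.\<close>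

lemma proves_cut:
  assumes "proves L \<Gamma> A" "proves L (insert A \<Gamma>) B"
  shows "proves L \<Gamma> B"
  using assms by (meson OrE OrI1 proves_wf)

lemma proves_trans:
  assumes "proves L (insert A \<Gamma>) B" "proves L (insert B \<Gamma>) C"
  shows "proves L (insert A \<Gamma>) C"
  using assms(1) by (rule proves_cut) (rule proves_mono[OF assms(2)], blast)

lemma proves_exfalso:
  assumes "proves L \<Gamma> A" "proves L \<Gamma> (Neg A)" "wf_form L B"
  shows "proves L \<Gamma> B"
  by (rule Contr[OF assms(3)]; rule proves_mono[OF assms(1)] proves_mono[OF assms(2)]; blast)

text \<open>\<open>Or (Neg A) B\<close> plays the part of an implication, so that a true
  quantifier-free implication can be turned into a derivation from \<open>A\<close>.\<close>

lemma proves_modus_ponens: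
  assumes "proves L \<Gamma> (Or (Neg A) B)"
  shows "proves L (insert A \<Gamma>) B"
proof -
  have wf: "wf_form L A" "wf_form L B" using proves_wf[OF assms] by auto
  have "proves L (insert A \<Gamma>) (Or (Neg A) B)" using assms by (rule proves_mono) blast
  then show ?thesis
    by (rule OrE) (rule proves_exfalso[of _ _ A], simp_all add: Assm wf)
qed

text \<open>Each use of \<open>AllE\<close> leaves an instantiation behind. The substitution
  \<open>\<sigma>\<close> accumulates these, which is why the induction has to carry it.\<close>

lemma proves_All_pow_subst:
  assumes "proves L \<Gamma> (subst_form \<sigma> ((All ^^ n) A))" "\<And>m. wf_trm L (\<tau> m)"
  shows "proves L \<Gamma> (subst_form (\<lambda>m. if m < n then \<tau> m else \<sigma> (m - n)) A)"
  using assms(1)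
proof (induction n arbitrary: \<sigma>)
  case (Suc n)
  \<comment> \<open>The outermost of the \<open>Suc n\<close> quantifiers binds index
    \<open>n\<close> of the matrix, hence its instance is \<open>\<tau> n\<close>.\<close>
  have "proves L \<Gamma> (inst (\<tau> n) (subst_form (up \<sigma>) ((All ^^ n) A)))"
    using Suc.prems assms(2) by (auto intro: AllE)
  then have "proves L \<Gamma> (subst_form (\<lambda>m. if m < n then \<tau> m else case_nat (\<tau> n) \<sigma> (m - n)) A)"
    by (intro Suc.IH) (simp add: inst_up)
  moreover have "(\<lambda>m. if m < n then \<tau> m else case_nat (\<tau> n) \<sigma> (m - n)) =
      (\<lambda>m. if m < Suc n then \<tau> m else \<sigma> (m - Suc n))"
    by (rule ext) (auto simp: less_Suc_eq Suc_diff_Suc[symmetric] not_less split: nat.split)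
  ultimately show ?case by simp
qed simp

lemma proves_All_pow_open:
  assumes "proves L \<Gamma> ((All ^^ n) A)" "form_below n A"
  shows "proves L \<Gamma> A"
proof -
  \<comment> \<open>Each quantifier is instantiated by its own variable. Indices from
    \<open>n\<close> on would be shifted down, but the bound on \<open>A\<close> excludes
    them.\<close>
  have "proves L \<Gamma> (subst_form (\<lambda>m. if m < n then Var m else Var (m - n)) A)"
    using assms(1) by (intro proves_All_pow_subst) simp_all
  then show ?thesis using assms(2) by (simp add: subst_form_id)
qed

text \<open>The eigenvariable rules lift the whole context. A theory made of sentences is fixed by
  lifting, so over it these rules act as in a calculus with closed axioms.\<close>

definition lift_invariant :: "'f form set \<Rightarrow> bool" where
  "lift_invariant \<Gamma> \<longleftrightarrow> lift_form ` \<Gamma> = \<Gamma>"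

lemma lift_invariantI: "(\<And>A. A \<in> \<Gamma> \<Longrightarrow> form_below 0 A) \<Longrightarrow> lift_invariant \<Gamma>"
  unfolding lift_invariant_def by (force simp: subst_form_id)

lemma proves_All_pow_close:
  assumes "lift_invariant \<Gamma>" "proves L \<Gamma> A"
  shows "proves L \<Gamma> ((All ^^ n) A)"
  using assms by (induction n) (auto intro: AllI simp: lift_invariant_def)


section \<open>Provable equivalence\<close>

text \<open>Stands in for the missing biconditional. Free variables of \<open>A\<close> and
  \<open>B\<close> are parameters shared by both derivations, so the relation can be used under
  quantifiers.\<close>

definition proves_iff :: "'f language \<Rightarrow> 'f form set \<Rightarrow> 'f form \<Rightarrow> 'f form \<Rightarrow> bool" where
  "proves_iff L \<Gamma> A B \<longleftrightarrow> proves L (insert A \<Gamma>) B \<and> proves L (insert B \<Gamma>) A"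

lemma proves_iff_trans: "proves_iff L \<Gamma> A B \<Longrightarrow> proves_iff L \<Gamma> B C \<Longrightarrow> proves_iff L \<Gamma> A C"
  unfolding proves_iff_def by (blast intro: proves_trans)

lemma proves_iff_sym: "proves_iff L \<Gamma> A B \<Longrightarrow> proves_iff L \<Gamma> B A"
  by (simp add: proves_iff_def)

lemma proves_iff_wf: "proves_iff L \<Gamma> A B \<Longrightarrow> wf_form L A \<and> wf_form L B"
  unfolding proves_iff_def by (blast intro: proves_wf)

lemma proves_iff_Neg:
  assumes "proves_iff L \<Gamma> A B"
  shows "proves_iff L \<Gamma> (Neg A) (Neg B)"
proof -
  \<comment> \<open>Contraposition: the direction from \<open>B\<close> to \<open>A\<close> yields
    the one from \<open>Neg A\<close> to \<open>Neg B\<close>.\<close>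
  have *: "proves L (insert (Neg A) \<Gamma>) (Neg B)"
    if "proves L (insert B \<Gamma>) A" "wf_form L A" "wf_form L B" for A B :: "'a form"
  proof (rule NegI)
    show "proves L (insert B (insert (Neg A) \<Gamma>)) A"
      using that(1) by (rule proves_mono) blast
  qed (simp_all add: Assm that)
  show ?thesis
    using proves_iff_wf[OF assms] assms unfolding proves_iff_def by (blast intro: *)
qed

lemma proves_iff_And:
  assumes "proves_iff L \<Gamma> A A'" "proves_iff L \<Gamma> B B'"
  shows "proves_iff L \<Gamma> (And A B) (And A' B')"
proof -
  have *: "proves L (insert (And A B) \<Gamma>) (And A' B')"
    if "proves_iff L \<Gamma> A A'" "proves_iff L \<Gamma> B B'" for A A' B B' :: "'a form"
  proof -
    have "wf_form L (And A B)" using that by (auto dest: proves_iff_wf)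
    then have "proves L (insert (And A B) \<Gamma>) (And A B)" by (auto intro: Assm)
    then have "proves L (insert (And A B) \<Gamma>) A" "proves L (insert (And A B) \<Gamma>) B"
      by (rule AndE1, rule AndE2)
    then show ?thesis
      using that unfolding proves_iff_def by (blast intro: AndI proves_trans)
  qed
  show ?thesis
    using *[OF assms] *[OF assms[THEN proves_iff_sym]] by (simp add: proves_iff_def)
qed

lemma proves_iff_Or:
  assumes "proves_iff L \<Gamma> A A'" "proves_iff L \<Gamma> B B'"
  shows "proves_iff L \<Gamma> (Or A B) (Or A' B')"
proof -
  have *: "proves L (insert (Or A B) \<Gamma>) (Or A' B')"
    if "proves_iff L \<Gamma> A A'" "proves_iff L \<Gamma> B B'" for A A' B B' :: "'a form"
  proof -
    have wf: "wf_form L (Or A B)" "wf_form L A'" "wf_form L B'"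
      using that by (auto dest: proves_iff_wf)
    have "proves L (insert A \<Gamma>) (Or A' B')" "proves L (insert B \<Gamma>) (Or A' B')"
      using that wf unfolding proves_iff_def by (blast intro: OrI1 OrI2)+
    then have "proves L (insert A (insert (Or A B) \<Gamma>)) (Or A' B')"
      "proves L (insert B (insert (Or A B) \<Gamma>)) (Or A' B')"
      by (blast intro: proves_mono)+
    moreover have "proves L (insert (Or A B) \<Gamma>) (Or A B)" using wf by (simp add: Assm)
    ultimately show ?thesis by (blast intro: OrE)
  qed
  show ?thesis
    using *[OF assms] *[OF assms[THEN proves_iff_sym]] by (simp add: proves_iff_def)
qed

section \<open>Left and right quantifier rules over an invariant theory\<close>

lemma proves_Ex_left:
  assumes "lift_invariant \<Gamma>" "wf_form L A" "proves L (insert A \<Gamma>) (lift_form B)"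
  shows "proves L (insert (Ex A) \<Gamma>) B"
proof (rule ExE)
  show "proves L (insert (Ex A) \<Gamma>) (Ex A)" using assms(2) by (simp add: Assm)
  show "proves L (insert A (lift_form ` insert (Ex A) \<Gamma>)) (lift_form B)"
    using assms(1) by (intro proves_mono[OF assms(3)]) (auto simp: lift_invariant_def)
qed

lemma proves_All_right:
  assumes "lift_invariant \<Gamma>" "proves L (insert (lift_form A) \<Gamma>) B"
  shows "proves L (insert A \<Gamma>) (All B)"
  using assms by (intro AllI) (simp add: lift_invariant_def)

lemma proves_Ex_right:
  assumes "wf_trm L t" "proves L \<Gamma> (inst t A)"
  shows "proves L \<Gamma> (Ex A)"
  using assms proves_wf[OF assms(2)] by (auto intro: ExI simp: wf_inst)

lemma proves_All_left:
  assumes "wf_form L A" "wf_trm L t" "proves L (insert (inst t A) \<Gamma>) B"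
  shows "proves L (insert (All A) \<Gamma>) B"
proof -
  have "proves L (insert (All A) \<Gamma>) (All A)" using assms(1) by (simp add: Assm)
  then have "proves L (insert (All A) \<Gamma>) (inst t A)" using assms(2) by (rule AllE)
  then show ?thesis using assms(3) by (rule proves_trans)
qed

lemma proves_iff_Ex:
  assumes "lift_invariant \<Gamma>" "proves_iff L \<Gamma> A B"
  shows "proves_iff L \<Gamma> (Ex A) (Ex B)"
proof -
  have *: "proves L (insert (Ex A) \<Gamma>) (Ex B)" if "proves_iff L \<Gamma> A B" for A B :: "'a form"
  proof (rule proves_Ex_left[OF assms(1)])
    \<comment> \<open>The eigenvariable that satisfies \<open>A\<close> is itself the witness for
      \<open>B\<close>.\<close>
    have "proves L (insert A \<Gamma>) (inst (Var 0) (subst_form (up (\<lambda>n. Var (Suc n))) B))"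
      using that by (simp add: inst_Var_0_up_lift proves_iff_def)
    then show "proves L (insert A \<Gamma>) (lift_form (Ex B))"
      by (auto intro: proves_Ex_right[of L "Var 0"])
  qed (use that in \<open>auto dest: proves_iff_wf\<close>)
  show ?thesis
    using *[OF assms(2)] *[OF proves_iff_sym[OF assms(2)]] by (simp add: proves_iff_def)
qed

lemma proves_iff_All:
  assumes "lift_invariant \<Gamma>" "proves_iff L \<Gamma> A B"
  shows "proves_iff L \<Gamma> (All A) (All B)"
proof -
  have *: "proves L (insert (All A) \<Gamma>) (All B)" if "proves_iff L \<Gamma> A B" for A B :: "'a form"
  proof (rule proves_All_right[OF assms(1)])
    show "proves L (insert (lift_form (All A)) \<Gamma>) B"
      unfolding subst_form.simps
      by (rule proves_All_left[of _ _ "Var 0"])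
        (use that proves_iff_wf[OF that] in
          \<open>auto simp: inst_Var_0_up_lift proves_iff_def wf_subst_form wf_up\<close>)
  qed
  show ?thesis
    using *[OF assms(2)] *[OF proves_iff_sym[OF assms(2)]] by (simp add: proves_iff_def)
qed


section \<open>Embedding of languages\<close>

lemma map_subst_trm: "map_trm f (subst_trm \<sigma> t) = subst_trm (\<lambda>n. map_trm f (\<sigma> n)) (map_trm f t)"
  by (induction t) auto

lemma map_up: "map_trm f (up \<sigma> n) = up (\<lambda>n. map_trm f (\<sigma> n)) n"
  by (cases n) (simp_all add: map_subst_trm)

lemma map_subst_form:
  "map_form f (subst_form \<sigma> A) = subst_form (\<lambda>n. map_trm f (\<sigma> n)) (map_form f A)"
  by (induction A arbitrary: \<sigma>) (simp_all add: map_subst_trm map_up)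

lemma map_lift_form: "map_form f (lift_form A) = lift_form (map_form f A)"
  by (simp add: map_subst_form)

lemma map_inst: "map_form f (inst t A) = inst (map_trm f t) (map_form f A)"
proof -
  have "(\<lambda>n. map_trm f (case_nat t Var n)) = case_nat (map_trm f t) Var"
    by (rule ext) (simp split: nat.split)
  then show ?thesis by (simp add: inst_def map_subst_form)
qed

lemma map_All_pow: "map_form f ((All ^^ n) A) = (All ^^ n) (map_form f A)"
  by (induction n) auto

lemma qfree_map [simp]: "qfree (map_form f A) = qfree A"
  by (induction A) auto

lemma wf_map_trm: "(\<And>s. L' (f s) = L s) \<Longrightarrow> wf_trm L' (map_trm f t) = wf_trm L t"
  by (induction t) auto

lemma wf_map_form: "(\<And>s. L' (f s) = L s) \<Longrightarrow> wf_form L' (map_form f A) = wf_form L A"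
  by (induction A) (auto simp: wf_map_trm)

lemma eval_map:
  assumes "\<And>s. I' (f s) = I s"
  shows "eval I' e (map_trm f t) = eval I e t"
  by (induction t) (simp_all add: assms comp_def cong: map_cong)

lemma sat_map:
  assumes "\<And>s. I' (f s) = I s"
  shows "sat I' e (map_form f A) = sat I e A"
  by (induction A arbitrary: e) (simp_all add: eval_map[of I', OF assms])

text \<open>Renaming symbols with arities preserved commutes with lifting and instantiation, so
  every rule instance is sent to an instance of the same rule.\<close>

lemma proves_map:
  assumes L: "\<And>s. L' (f s) = L s"
  shows "proves L \<Gamma> A \<Longrightarrow> proves L' (map_form f ` \<Gamma>) (map_form f A)"
proof (induction rule: proves.induct)
  case (NegI A \<Gamma> B)
  then show ?case by (auto intro: proves.NegI simp: wf_map_form[of L', OF L])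
next
  case (Contr A \<Gamma> B)
  then show ?case by (auto intro: proves.Contr simp: wf_map_form[of L', OF L])
next
  case (OrE \<Gamma> A B C)
  then show ?case by (auto intro: proves.OrE)
next
  case (ExE \<Gamma> A C)
  have "proves L' (insert (map_form f A) (lift_form ` map_form f ` \<Gamma>)) (lift_form (map_form f C))"
    using ExE.IH(2) by (simp add: image_image map_lift_form)
  then show ?case using ExE.IH(1) by (simp add: proves.ExE)
next
  case (AllI \<Gamma> A)
  then have "proves L' (lift_form ` map_form f ` \<Gamma>) (map_form f A)"
    by (simp add: image_image map_lift_form)
  then show ?case by (simp add: proves.AllI)
next
  case (ExI A t \<Gamma>)
  then have "proves L' (map_form f ` \<Gamma>) (inst (map_trm f t) (map_form f A))"
    by (simp add: map_inst)
  with ExI.hyps show ?case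
    unfolding form.map
    by (intro proves.ExI[of _ _ "map_trm f t"])
      (simp_all add: wf_map_form[of L', OF L] wf_map_trm[of L', OF L])
next
  case (EqE A \<Gamma> s t)
  have "wf_form L' (map_form f A)"
    using EqE.hyps(1) by (simp add: wf_map_form[of L', OF L])
  then show ?case
    using EqE.IH unfolding map_inst form.map by (rule proves.EqE)
next
  case (AndE1 \<Gamma> A B)
  then show ?case unfolding form.map by (blast intro: proves.AndE1)
next
  case (AndE2 \<Gamma> A B)
  then show ?case unfolding form.map by (blast intro: proves.AndE2)
next
  case (AllE \<Gamma> A t)
  have "wf_trm L' (map_trm f t)"
    using AllE.hyps(2) by (simp add: wf_map_trm[of L', OF L])
  with AllE.IH show ?case
    unfolding map_inst form.map by (rule proves.AllE)
qed (simp_all add: proves.Assm proves.AndI proves.OrI1 proves.OrI2 proves.EqI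
    wf_map_form[of L', OF L] wf_map_trm[of L', OF L])

text \<open>
  Closed hypotheses are not affected by the lifting in \<open>ExE\<close> and \<open>AllI\<close>; this makes the cut
  possible without a substitution lemma for derivations.
\<close>

lemma proves_cut_theory:
  assumes "lift_invariant \<Delta>" "lift_invariant S" "\<And>B. B \<in> S \<Longrightarrow> proves L \<Delta> B"
  shows "proves L \<Gamma> A \<Longrightarrow> \<Gamma> \<subseteq> S \<union> \<Gamma>' \<Longrightarrow> proves L (\<Delta> \<union> \<Gamma>') A"
proof (induction arbitrary: \<Gamma>' rule: proves.induct)
  case (Assm A \<Gamma>)
  then show ?case
    using assms(3) by (auto intro: proves.Assm proves_mono[of _ \<Delta>])
next
  case (NegI A \<Gamma> B)
  then show ?case
    using NegI.IH[of "insert A \<Gamma>'"] by (auto intro: proves.NegI)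
next
  case (Contr A \<Gamma> B)
  then show ?case
    using Contr.IH[of "insert (Neg A) \<Gamma>'"] by (auto intro: proves.Contr)
next
  case (OrE \<Gamma> A B C)
  then have "proves L (insert A (\<Delta> \<union> \<Gamma>')) C" "proves L (insert B (\<Delta> \<union> \<Gamma>')) C"
    using OrE.IH(2)[of "insert A \<Gamma>'"] OrE.IH(3)[of "insert B \<Gamma>'"] by auto
  then show ?case
    using OrE.IH(1) OrE.prems by (blast intro: proves.OrE)
next
  case (ExE \<Gamma> A C)
  \<comment> \<open>Lifting maps \<open>S\<close> to itself, so only the part of the context in
    \<open>\<Gamma>'\<close> changes, and the induction hypothesis absorbs that change.\<close>
  have "lift_form ` \<Gamma> \<subseteq> S \<union> lift_form ` \<Gamma>'"
    using ExE.prems assms(2) unfolding lift_invariant_def by blast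
  then have "proves L (\<Delta> \<union> insert A (lift_form ` \<Gamma>')) (lift_form C)"
    by (intro ExE.IH(2)) blast
  then have "proves L (insert A (lift_form ` (\<Delta> \<union> \<Gamma>'))) (lift_form C)"
    using assms(1) by (simp add: lift_invariant_def image_Un)
  then show ?case
    using ExE.IH(1) ExE.prems by (blast intro: proves.ExE)
next
  case (AllI \<Gamma> A)
  have "lift_form ` \<Gamma> \<subseteq> S \<union> lift_form ` \<Gamma>'"
    using AllI.prems assms(2) unfolding lift_invariant_def by blast
  then have "proves L (lift_form ` (\<Delta> \<union> \<Gamma>')) A"
    using AllI.IH assms(1) by (simp add: lift_invariant_def image_Un)
  then show ?case by (rule proves.AllI)
qed (blast intro: proves.intros)+


section \<open>Elimination of bounded formulas over the universal theory\<close>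

lemma lift_invariant_U_PV: "lift_invariant (U_PV i)"
  by (rule lift_invariantI) (auto simp: U_PV_def sentence_def)

text \<open>The universal closure of \<open>A\<close> is an axiom, and its quantifiers can be
  removed again.\<close>

lemma U_PV_proves_qfree:
  assumes "qfree A" "wf_form (L_PVi i) A" "true_in I_PVi A"
  shows "proves (L_PVi i) (U_PV i) A"
proof -
  obtain n where n: "form_below n A" using ex_form_below by blast
  then have "(All ^^ n) A \<in> U_PV i"
    using assms by (auto simp: U_PV_def sentence_def)
  then have "proves (L_PVi i) (U_PV i) ((All ^^ n) A)"
    using assms(2) by (simp add: Assm)
  then show ?thesis using n by (rule proves_All_pow_open)
qed

text \<open>The passage from semantics to derivations: an implication between quantifier-free
  formulas that holds in the standard model is an axiom up to closure.\<close>

lemma U_PV_proves_imp: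
  assumes "qfree A" "qfree B" "wf_form (L_PVi i) A" "wf_form (L_PVi i) B"
    and "\<And>e. sat I_PVi e A \<Longrightarrow> sat I_PVi e B"
  shows "proves (L_PVi i) (insert A (U_PV i)) B"
  using assms
  by (intro proves_modus_ponens U_PV_proves_qfree) (auto simp: true_in_def)

lemma U_PV_proves_iff:
  assumes "qfree A" "qfree B" "wf_form (L_PVi i) A" "wf_form (L_PVi i) B"
    and "\<And>e. sat I_PVi e A = sat I_PVi e B"
  shows "proves_iff (L_PVi i) (U_PV i) A B"
  using assms by (auto simp: proves_iff_def intro: U_PV_proves_imp)

section \<open>Inclusions between the classes, characteristic atoms and minimization terms\<close>

lemma bounded_mono:
  assumes "j \<le> l"
  shows "Sigma_b j A \<Longrightarrow> Sigma_b l A" "Pi_b j A \<Longrightarrow> Pi_b l A"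
  using lift_Suc_mono_le[of "\<lambda>j. Sigma_b j A", OF _ assms]
    lift_Suc_mono_le[of "\<lambda>j. Pi_b j A", OF _ assms] Sigma_b_Pi_b.intros(3,6)
  by (auto simp: le_bool_def)

text \<open>The number \<open>k\<close> of arguments is explicit because it grows by one under a
  quantifier, and symbols with different \<open>k\<close> are different.\<close>

definition char_atom :: "nat \<Rightarrow> pv_symbol form \<Rightarrow> pvi_symbol form" where
  "char_atom k A = Eq (Fn (CharF k A) (map Var [0..<k])) (Fn (Base One) [])"

text \<open>Its variables are those of the quantified formula, outside the quantifier, so it can
  instantiate the bound variable.\<close>

definition min_trm :: "nat \<Rightarrow> pv_symbol form \<Rightarrow> pv_symbol trm \<Rightarrow> pvi_symbol trm" where
  "min_trm k B t = Fn (MinF k B t) (map Var [0..<k])"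

lemma qfree_char_atom [simp]: "qfree (char_atom k A)"
  by (simp add: char_atom_def)

lemma wf_char_atom [simp]:
  assumes "wf_form L_PV A" "form_below k A" "Sigma_b (i - 1) A \<or> Pi_b (i - 1) A"
  shows "wf_form (L_PVi i) (char_atom k A)"
  using assms by (auto simp: char_atom_def)

text \<open>The argument list carries only the first \<open>k\<close> values of \<open>e\<close>,
  and by the bound on \<open>A\<close> these decide its truth.\<close>

lemma sat_char_atom:
  assumes "form_below k A"
  shows "sat I_PVi e (char_atom k A) = sat I_PV e A"
proof -
  have "sat I_PV (\<lambda>j. map e [0..<k] ! j) A = sat I_PV e A"
    using assms by (rule sat_cong) simp
  then show ?thesis by (simp add: char_atom_def comp_def)
qed

lemma wf_min_trm:
  assumes "2 \<le> i" "wf_form L_PV B" "form_below (Suc k) B" "Sigma_b (i - 1) B"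
    "wf_trm L_PV t" "trm_below k t"
  shows "wf_trm (L_PVi i) (min_trm k B t)"
  using assms by (auto simp: min_trm_def)

text \<open>The solution \<open>y\<close> below the bound rules out the default value 0, and the
  least solution is at most \<open>y\<close>.\<close>

lemma eval_min_trm:
  assumes "form_below (Suc k) B" "trm_below k t"
    and "y \<le> eval I_PV e t" "sat I_PV (case_nat y e) B"
  shows "eval I_PVi e (min_trm k B t) \<le> eval I_PV e t"
    and "sat I_PV (case_nat (eval I_PVi e (min_trm k B t)) e) B"
proof -
  have t: "eval I_PV (\<lambda>j. map e [0..<k] ! j) t = eval I_PV e t"
    using assms(2) by (rule eval_cong) simp
  have B: "sat I_PV (case_nat z (\<lambda>j. map e [0..<k] ! j)) B = sat I_PV (case_nat z e) B" for z
    using assms(1) by (rule sat_cong) (simp split: nat.split)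
  have "eval I_PVi e (min_trm k B t) = (LEAST z. sat I_PV (case_nat z e) B)"
    using assms(3,4) by (auto simp: min_trm_def comp_def t B)
  then show "eval I_PVi e (min_trm k B t) \<le> eval I_PV e t"
    "sat I_PV (case_nat (eval I_PVi e (min_trm k B t)) e) B"
    using Least_le[of "\<lambda>z. sat I_PV (case_nat z e) B", OF assms(4)]
      LeastI[of "\<lambda>z. sat I_PV (case_nat z e) B", OF assms(4)] assms(3) by auto
qed

section \<open>Bounded quantifiers and embedded formulas\<close>

lemma sat_Leq_bound: "sat I_PV (case_nat y e) (Leq (Var 0) (lift_trm t)) \<longleftrightarrow> y \<le> eval I_PV e t"
  by (simp add: Leq_def eval_subst)

lemma sat_BEx: "sat I_PV e (BEx t A) \<longleftrightarrow> (\<exists>y \<le> eval I_PV e t. sat I_PV (case_nat y e) A)"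
  by (simp add: BEx_def sat_Leq_bound)

lemma sat_BAll: "sat I_PV e (BAll t A) \<longleftrightarrow> (\<forall>y \<le> eval I_PV e t. sat I_PV (case_nat y e) A)"
  by (auto simp: BAll_def sat_Leq_bound)

lemma sat_map_Base [simp]: "sat I_PVi e (map_form Base A) = sat I_PV e A"
  by (rule sat_map) auto

lemma wf_map_Base [simp]: "wf_form (L_PVi i) (map_form Base A) = wf_form L_PV A"
  by (rule wf_map_form) simp

lemma proves_iff_map_Base_refl:
  "wf_form L_PV A \<Longrightarrow> proves_iff (L_PVi i) \<Gamma> (map_form Base A) (map_form Base A)"
  by (simp add: proves_iff_def Assm)

lemma wf_Leq_bound:
  "wf_trm L_PV t \<Longrightarrow> wf_form L_PV (Leq (Var 0) (lift_trm t))"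
  by (simp add: Leq_def wf_subst_trm polytime_leq)

lemma qfree_Leq [simp]: "qfree (Leq s t)"
  by (simp add: Leq_def)

text \<open>Replacing the matrix by its atom turns the formula into \<open>Ex D\<close> with
  \<open>D\<close> quantifier-free. Then \<open>D\<close> at any witness implies the atom of the
  whole formula, and that atom implies \<open>D\<close> at the least witness. Both are true
  implications without quantifiers.\<close>

lemma BEx_iff_char_atom:
  assumes "1 \<le> j" "j < i" "Sigma_b j A" "wf_form L_PV (BEx t A)" "form_below k (BEx t A)"
    and iff: "proves_iff (L_PVi i) (U_PV i) (map_form Base A) (char_atom (Suc k) A)"
  shows "proves_iff (L_PVi i) (U_PV i) (map_form Base (BEx t A)) (char_atom k (BEx t A))"
proof -
  have A: "wf_form L_PV A" "form_below (Suc k) A" "Sigma_b (i - 1) A"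
    and t: "wf_trm L_PV t" "trm_below k t"
    using assms bounded_mono(1)[of j "i - 1"]
    by (auto simp: BEx_def Leq_def wf_subst_trm)
  have "Sigma_b j (BEx t A)"
    using assms(1,3) by (cases j) (auto intro: Sigma_b_Pi_b.intros)
  then have BEx: "Sigma_b (i - 1) (BEx t A)"
    using assms(2) bounded_mono(1)[of j "i - 1"] by simp
  define D where "D = And (map_form Base (Leq (Var 0) (lift_trm t))) (char_atom (Suc k) A)"
  have D: "qfree D" "wf_form (L_PVi i) D"
    using A t by (simp_all add: D_def wf_Leq_bound)
  have wf: "wf_form (L_PVi i) (char_atom k (BEx t A))"
    using assms(4,5) BEx by simp
  \<comment> \<open>From \<open>1 \<le> j\<close> and \<open>j < i\<close> follows
    \<open>2 \<le> i\<close>, the condition for having minimization symbols.\<close>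
  have g: "wf_trm (L_PVi i) (min_trm k A t)"
    using assms(1,2) A t by (intro wf_min_trm) auto
  have sat_D: "sat I_PVi (case_nat y e) D \<longleftrightarrow> y \<le> eval I_PV e t \<and> sat I_PV (case_nat y e) A"
    for y e using A by (simp add: D_def sat_Leq_bound sat_char_atom)
  have "proves_iff (L_PVi i) (U_PV i) (map_form Base (BEx t A)) (Ex D)"
    using iff t unfolding BEx_def D_def form.map
    by (intro proves_iff_Ex proves_iff_And lift_invariant_U_PV proves_iff_map_Base_refl
        wf_Leq_bound)
  moreover have "proves (L_PVi i) (insert (Ex D) (U_PV i)) (char_atom k (BEx t A))"
  proof (intro proves_Ex_left lift_invariant_U_PV U_PV_proves_imp)
    \<comment> \<open>Here \<open>e 0\<close> is the value of the eigenvariable, that is, the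
      witness, and the shifted environment interprets the variables outside the quantifier.\<close>
    fix e :: "nat \<Rightarrow> nat"
    assume "sat I_PVi e D"
    then have "e 0 \<le> eval I_PV (\<lambda>n. e (Suc n)) t"
      "sat I_PV (case_nat (e 0) (\<lambda>n. e (Suc n))) A"
      using sat_D[of "e 0" "\<lambda>n. e (Suc n)"] by (simp_all add: case_nat_eta)
    then have "sat I_PV (\<lambda>n. e (Suc n)) (BEx t A)"
      by (auto simp: sat_BEx)
    then show "sat I_PVi e (lift_form (char_atom k (BEx t A)))"
      using assms(5) by (simp add: sat_subst sat_char_atom)
  qed (use D wf in \<open>simp_all add: wf_subst_form\<close>)
  moreover have "proves (L_PVi i) (insert (char_atom k (BEx t A)) (U_PV i)) (Ex D)"
  proof (rule proves_Ex_right[OF g], rule U_PV_proves_imp)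
    fix e
    assume "sat I_PVi e (char_atom k (BEx t A))"
    then show "sat I_PVi e (inst (min_trm k A t) D)"
      using assms(5) eval_min_trm[OF A(2) t(2)]
      by (auto simp: sat_char_atom sat_BEx sat_inst sat_D)
  qed (use D wf g in \<open>simp_all add: wf_inst\<close>, simp_all add: inst_def D)
  ultimately show ?thesis
    by (meson proves_iff_def proves_iff_trans)
qed

text \<open>Dual to the existential case: the decisive instance of \<open>All D\<close> is the least
  counterexample. If \<open>D\<close> holds there, no counterexample lies below the bound.\<close>

lemma BAll_iff_char_atom:
  assumes "1 \<le> j" "j < i" "Pi_b j A" "wf_form L_PV (BAll t A)" "form_below k (BAll t A)"
    and iff: "proves_iff (L_PVi i) (U_PV i) (map_form Base A) (char_atom (Suc k) A)"
  shows "proves_iff (L_PVi i) (U_PV i) (map_form Base (BAll t A)) (char_atom k (BAll t A))"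
proof -
  \<comment> \<open>Only \<open>\<Sigma>\<close> formulas may be minimized, so the search for a
    counterexample uses the negated matrix.\<close>
  have "Sigma_b j (Neg A)" "Pi_b j (BAll t A)"
    using assms(1,3) by (cases j; auto intro: Sigma_b_Pi_b.intros)+
  then have A: "wf_form L_PV A" "form_below (Suc k) A" "Pi_b (i - 1) A"
    and neg: "wf_form L_PV (Neg A)" "form_below (Suc k) (Neg A)" "Sigma_b (i - 1) (Neg A)"
    and t: "wf_trm L_PV t" "trm_below k t"
    and BAll: "Pi_b (i - 1) (BAll t A)"
    using assms bounded_mono[of j "i - 1"]
    by (auto simp: BAll_def Leq_def wf_subst_trm)
  define D where "D = Or (Neg (map_form Base (Leq (Var 0) (lift_trm t)))) (char_atom (Suc k) A)"
  have D: "qfree D" "wf_form (L_PVi i) D"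
    using A t by (simp_all add: D_def wf_Leq_bound)
  have wf: "wf_form (L_PVi i) (char_atom k (BAll t A))"
    using assms(4,5) BAll by simp
  have g: "wf_trm (L_PVi i) (min_trm k (Neg A) t)"
    using assms(1,2) neg t by (intro wf_min_trm) auto
  have sat_D: "sat I_PVi (case_nat y e) D \<longleftrightarrow> (y \<le> eval I_PV e t \<longrightarrow> sat I_PV (case_nat y e) A)"
    for y e using A by (auto simp: D_def sat_Leq_bound sat_char_atom)
  have "proves_iff (L_PVi i) (U_PV i) (map_form Base (BAll t A)) (All D)"
    using iff t unfolding BAll_def D_def form.map
    by (intro proves_iff_All proves_iff_Or proves_iff_Neg lift_invariant_U_PV
        proves_iff_map_Base_refl wf_Leq_bound)
  moreover have "proves (L_PVi i) (insert (char_atom k (BAll t A)) (U_PV i)) (All D)"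
  proof (intro proves_All_right lift_invariant_U_PV U_PV_proves_imp)
    fix e :: "nat \<Rightarrow> nat"
    assume "sat I_PVi e (lift_form (char_atom k (BAll t A)))"
    then have "sat I_PV (\<lambda>n. e (Suc n)) (BAll t A)"
      using assms(5) by (simp add: sat_subst sat_char_atom)
    then have "sat I_PVi (case_nat (e 0) (\<lambda>n. e (Suc n))) D"
      by (auto simp: sat_BAll sat_D)
    then show "sat I_PVi e D" by (simp add: case_nat_eta)
  qed (use D wf in \<open>simp_all add: wf_subst_form\<close>)
  moreover have "proves (L_PVi i) (insert (All D) (U_PV i)) (char_atom k (BAll t A))"
  proof (rule proves_All_left[OF D(2) g], rule U_PV_proves_imp)
    fix e
    assume "sat I_PVi e (inst (min_trm k (Neg A) t) D)"
    then show "sat I_PVi e (char_atom k (BAll t A))"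
      using assms(5) eval_min_trm[OF neg(2) t(2)]
      by (auto simp: sat_char_atom sat_BAll sat_inst sat_D)
  qed (use D wf g in \<open>simp_all add: wf_inst\<close>, simp_all add: inst_def D)
  ultimately show ?thesis
    by (meson proves_iff_def proves_iff_trans)
qed

section \<open>Propositional connectives\<close>

lemma And_iff_char_atom:
  assumes "proves_iff (L_PVi i) (U_PV i) (map_form Base A) (char_atom k A)"
    and "proves_iff (L_PVi i) (U_PV i) (map_form Base B) (char_atom k B)"
    and "form_below k (And A B)" "wf_form (L_PVi i) (char_atom k (And A B))"
  shows "proves_iff (L_PVi i) (U_PV i) (map_form Base (And A B)) (char_atom k (And A B))"
proof (rule proves_iff_trans)
  show "proves_iff (L_PVi i) (U_PV i) (map_form Base (And A B))
      (And (char_atom k A) (char_atom k B))"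
    using assms(1,2) by (simp add: proves_iff_And)
  \<comment> \<open>With atoms in place of the subformulas, both sides are quantifier-free and agree
    in the standard model.\<close>
  show "proves_iff (L_PVi i) (U_PV i) (And (char_atom k A) (char_atom k B))
      (char_atom k (And A B))"
    using assms proves_iff_wf by (intro U_PV_proves_iff) (auto simp: sat_char_atom)
qed

lemma Or_iff_char_atom:
  assumes "proves_iff (L_PVi i) (U_PV i) (map_form Base A) (char_atom k A)"
    and "proves_iff (L_PVi i) (U_PV i) (map_form Base B) (char_atom k B)"
    and "form_below k (Or A B)" "wf_form (L_PVi i) (char_atom k (Or A B))"
  shows "proves_iff (L_PVi i) (U_PV i) (map_form Base (Or A B)) (char_atom k (Or A B))"
proof (rule proves_iff_trans)
  show "proves_iff (L_PVi i) (U_PV i) (map_form Base (Or A B))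
      (Or (char_atom k A) (char_atom k B))"
    using assms(1,2) by (simp add: proves_iff_Or)
  show "proves_iff (L_PVi i) (U_PV i) (Or (char_atom k A) (char_atom k B))
      (char_atom k (Or A B))"
    using assms proves_iff_wf by (intro U_PV_proves_iff) (auto simp: sat_char_atom)
qed

lemma Neg_iff_char_atom:
  assumes "proves_iff (L_PVi i) (U_PV i) (map_form Base A) (char_atom k A)"
    and "form_below k (Neg A)" "wf_form (L_PVi i) (char_atom k (Neg A))"
  shows "proves_iff (L_PVi i) (U_PV i) (map_form Base (Neg A)) (char_atom k (Neg A))"
proof (rule proves_iff_trans)
  show "proves_iff (L_PVi i) (U_PV i) (map_form Base (Neg A)) (Neg (char_atom k A))"
    using assms(1) by (simp add: proves_iff_Neg)
  show "proves_iff (L_PVi i) (U_PV i) (Neg (char_atom k A)) (char_atom k (Neg A))"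
    using assms proves_iff_wf by (intro U_PV_proves_iff) (auto simp: sat_char_atom)
qed

lemma qfree_iff_char_atom:
  assumes "qfree A" "wf_form L_PV A" "form_below k A"
  shows "proves_iff (L_PVi i) (U_PV i) (map_form Base A) (char_atom k A)"
proof -
  have "Sigma_b (i - 1) A"
    using assms(1) by (intro bounded_mono(1)[of 0 "i - 1"] Sigma_b_Pi_b.intros(1)) simp_all
  then show ?thesis
    using assms by (intro U_PV_proves_iff) (auto simp: sat_char_atom)
qed

section \<open>Induction over the bounded classes and transfer of the axioms\<close>

lemma wf_char_atom_bounded:
  assumes "Sigma_b j A \<or> Pi_b j A" "j < i" "wf_form L_PV A" "form_below k A"
  shows "wf_form (L_PVi i) (char_atom k A)"
  using assms bounded_mono[of j "i - 1" A] by auto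

text \<open>Simultaneous induction on the generation of both classes, since negation exchanges them.
  The bound \<open>k\<close> varies because a matrix has one more free variable than the quantified
  formula, and \<open>j < i\<close> provides the symbols for all formulas met on the way.\<close>

lemma bounded_iff_char_atom:
  "Sigma_b j A \<Longrightarrow> j < i \<Longrightarrow> wf_form L_PV A \<Longrightarrow> form_below k A \<Longrightarrow>
    proves_iff (L_PVi i) (U_PV i) (map_form Base A) (char_atom k A)"
  "Pi_b j A \<Longrightarrow> j < i \<Longrightarrow> wf_form L_PV A \<Longrightarrow> form_below k A \<Longrightarrow>
    proves_iff (L_PVi i) (U_PV i) (map_form Base A) (char_atom k A)"
proof (induction arbitrary: k and k rule: Sigma_b_Pi_b.inducts)
  case (7 j A B)
  then have "wf_form (L_PVi i) (char_atom k (And A B))"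
    by (intro wf_char_atom_bounded[of "Suc j"]) (auto intro: Sigma_b_Pi_b.intros)
  with 7 show ?case by (intro And_iff_char_atom) auto
next
  case (8 j A B)
  then have "wf_form (L_PVi i) (char_atom k (Or A B))"
    by (intro wf_char_atom_bounded[of "Suc j"]) (auto intro: Sigma_b_Pi_b.intros)
  with 8 show ?case by (intro Or_iff_char_atom) auto
next
  case (9 j A B)
  then have "wf_form (L_PVi i) (char_atom k (And A B))"
    by (intro wf_char_atom_bounded[of "Suc j"]) (auto intro: Sigma_b_Pi_b.intros)
  with 9 show ?case by (intro And_iff_char_atom) auto
next
  case (10 j A B)
  then have "wf_form (L_PVi i) (char_atom k (Or A B))"
    by (intro wf_char_atom_bounded[of "Suc j"]) (auto intro: Sigma_b_Pi_b.intros)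
  with 10 show ?case by (intro Or_iff_char_atom) auto
next
  case (11 j A t)
  have "wf_form L_PV A" "form_below (Suc k) A"
    using "11.prems" by (auto simp: BEx_def)
  with 11 show ?case by (intro BEx_iff_char_atom[of "Suc j"]) auto
next
  case (12 j A t)
  have "wf_form L_PV A" "form_below (Suc k) A"
    using "12.prems" by (auto simp: BAll_def)
  with 12 show ?case by (intro BAll_iff_char_atom[of "Suc j"]) auto
next
  case (13 j A)
  then have "wf_form (L_PVi i) (char_atom k (Neg A))"
    by (intro wf_char_atom_bounded[of "Suc j"]) (auto intro: Sigma_b_Pi_b.intros)
  with 13 show ?case by (intro Neg_iff_char_atom) auto
next
  case (14 j A)
  then have "wf_form (L_PVi i) (char_atom k (Neg A))"
    by (intro wf_char_atom_bounded[of "Suc j"]) (auto intro: Sigma_b_Pi_b.intros)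
  with 14 show ?case by (intro Neg_iff_char_atom) auto
\<comment> \<open>What remains are the quantifier-free formulas and the inclusions between classes,
  where the formula itself stays the same.\<close>
qed (simp_all add: qfree_iff_char_atom)

text \<open>The matrix of a true axiom has a true characteristic atom, which is provable as a
  quantifier-free formula. The equivalence carries this over to the matrix, and generalization
  restores the quantifiers.\<close>

lemma U_PV_proves_T_PV:
  assumes "1 \<le> i" "B \<in> T_PV i"
  shows "proves (L_PVi i) (U_PV i) (map_form Base B)"
proof -
  obtain n A where B: "B = (All ^^ n) A" and A: "Sigma_b (i - 1) A"
    "wf_form L_PV A" "form_below n A" "true_in I_PV A"
    using assms(2) by (auto simp: T_PV_def sentence_def)
  have "proves (L_PVi i) (U_PV i) (char_atom n A)"
    using A by (intro U_PV_proves_qfree) (simp_all add: true_in_def sat_char_atom)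
  moreover have "proves_iff (L_PVi i) (U_PV i) (map_form Base A) (char_atom n A)"
    using A assms(1) by (intro bounded_iff_char_atom(1)[of "i - 1"]) auto
  ultimately have "proves (L_PVi i) (U_PV i) (map_form Base A)"
    unfolding proves_iff_def by (blast intro: proves_cut)
  then show ?thesis
    by (simp add: B map_All_pow proves_All_pow_close lift_invariant_U_PV)
qed

theorem theorem2p14:
  fixes i :: nat and \<phi> :: "pv_symbol form"
  assumes "i \<ge> 1"
    and "sentence L_PV \<phi>"
    and "proves L_PV (T_PV i) \<phi>"
  shows "proves (L_PVi i) (U_PV i) (map_form Base \<phi>)"
proof -
  have "lift_form (map_form Base B) = map_form Base B" if "B \<in> T_PV i" for B
  proof -
    have "form_below 0 B" using that by (auto simp: T_PV_def sentence_def)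
    then show ?thesis by (simp add: subst_form_id flip: map_lift_form)
  qed
  then have "lift_invariant (map_form Base ` T_PV i)"
    by (simp add: lift_invariant_def image_image cong: image_cong)
  \<comment> \<open>The derivation is first read in the larger language; afterwards its axioms are
    replaced by their derivations from the universal theory.\<close>
  moreover have "proves (L_PVi i) (map_form Base ` T_PV i) (map_form Base \<phi>)"
    using assms(3) by (intro proves_map) simp_all
  ultimately have "proves (L_PVi i) (U_PV i \<union> {}) (map_form Base \<phi>)"
    using U_PV_proves_T_PV[OF assms(1)]
    by (intro proves_cut_theory[OF lift_invariant_U_PV, of "map_form Base ` T_PV i"]) auto
  then show ?thesis by simp
qed

end
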